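(* Let $J$, $\overline{J}$, $\underline{J}$ be as in the context, and suppose there is a constant $L>0$ such that for all $\theta,\theta'\in\mathbb{R}^d$ and all $\overline{\mathbf u}\in\mathcal U$ $$\overline{J}(\theta',\overline{\mathbf u})\le\overline{J}(\theta,\overline{\mathbf u})+\nabla_\theta\overline{J}(\theta,\overline{\mathbf u})^T(\theta'-\theta)+\frac{L}{2}\lVert\theta'-\theta\rVert^2 .$$ Let $\rho\in(0,1)$, and let $(\theta^{(t)})_{t\ge 0}$, $(\overline{\mathbf u}^{(t)})_{t\ge 1}$, $(\underline{\mathbf u}^{(t)})_{t\ge 1}$ be sequences such that for every $t\ge 1$ $$\overline{J}(\theta^{(t-1)},\overline{\mathbf u}^{(t)})-\underline{J}(\theta^{(t-1)},\underline{\mathbf u}^{(t)})\le\frac{\rho}{2L}\bigl\lVert\nabla_\theta\overline{J}(\theta^{(t-1)},\overline{\mathbf u}^{(t)})\bigr\rVert^2$$ and $$\theta^{(t)}=\theta^{(t-1)}-\frac1L\nabla_\theta\overline{J}(\theta^{(t-1)},\overline{\mathbf u}^{(t)}).$$ Then $$\lim_{t\to\infty}\nabla_\theta\overline{J}(\theta^{(t-1)},\overline{\mathbf u}^{(t)})=0.$$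
   Context: $J:\mathbb{R}^d\to\mathbb{R}_{\ge 0}$ is a differentiable function. $\mathcal U\subseteq\mathbb{R}^{\bar D}$, and $\overline{J}(\theta,\overline{\mathbf u})$ is a real-valued differentiable function of $\theta\in\mathbb{R}^d$ and $\overline{\mathbf u}\in\mathcal U$ such that: (1) $\overline{J}(\theta,\overline{\mathbf u})\ge J(\theta)$ for all $\theta\in\mathbb{R}^d$, $\overline{\mathbf u}\in\mathcal U$; (2) $\overline{J}(\theta,\overline{\mathbf u})$ is convex in $\overline{\mathbf u}$ and satisfies strong duality; (3) $J(\theta)=\min_{\overline{\mathbf u}\in\mathcal U}\overline{J}(\theta,\overline{\mathbf u})$ for all $\theta$. The dual objective is a real-valued function $\underline{J}(\theta,\underline{\mathbf u})$ with a dual parameter $\underline{\mathbf u}$ ranging over some set, with $\underline{J}(\theta,\underline{\mathbf u})\le J(\theta)$ for all $\theta,\underline{\mathbf u}$. Strong duality means that $\sup_{\underline{\mathbf u}}\underline{J}(\theta,\underline{\mathbf u})=J(\theta)$ for every $\theta$. $\lVert\cdot\rVert$ is the Euclidean norm. *)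

theory Defs
  imports "HOL-Analysis.Analysis"
begin

(* The library only has the relation GDERIV f x :> D; this is the corresponding vector,
   meaningful where f is differentiable (see gradient_works). *)
definition gradient :: "('a::euclidean_space \<Rightarrow> real) \<Rightarrow> 'a \<Rightarrow> 'a" where
  "gradient f x = (THE D. GDERIV f x :> D)"

lemma gradient_eqI:
  assumes "GDERIV f x :> D"
  shows "gradient f x = D"
proof -
  have "E = D" if "GDERIV f x :> E" for E
  proof -
    have "(\<lambda>h. h \<bullet> E) = (\<lambda>h. h \<bullet> D)"
      using that assms unfolding gderiv_def by (rule has_derivative_unique)
    then have "(E - D) \<bullet> E = (E - D) \<bullet> D"
      by (rule fun_cong)
    then have "(E - D) \<bullet> (E - D) = 0"
      by (simp add: inner_diff_right)
    then show ?thesis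
      by simp
  qed
  with assms show ?thesis
    unfolding gradient_def by blast
qed

lemma gradient_works:
  assumes "f differentiable (at x)"
  shows "GDERIV f x :> gradient f x"
proof -
  obtain f' where f': "(f has_derivative f') (at x)"
    using assms unfolding differentiable_def by blast
  then have "linear f'"
    by (rule has_derivative_linear)
  define D where "D = (\<Sum>b\<in>Basis. f' b *\<^sub>R b)"
  have "f' h = h \<bullet> D" for h
  proof -
    have "f' h = f' (\<Sum>b\<in>Basis. (h \<bullet> b) *\<^sub>R b)"
      by (simp only: euclidean_representation)
    also have "\<dots> = (\<Sum>b\<in>Basis. (h \<bullet> b) * f' b)"
      using \<open>linear f'\<close> by (simp add: linear_sum linear_cmul)
    finally show ?thesis
      by (simp add: D_def inner_sum_right mult.commute)
  qed
  then have "f' = (\<lambda>h. h \<bullet> D)"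
    by (rule ext)
  with f' have D: "GDERIV f x :> D"
    unfolding gderiv_def by (simp only:)
  show ?thesis
    unfolding gradient_eqI [OF D] by (rule D)
qed

(* The supremum is taken in ereal, where the supremum of the empty set is -\<infinity>,
   so that a nonempty dual parameter set V is implied rather than assumed. *)
definition strong_duality ::
  "('a \<Rightarrow> real) \<Rightarrow> 'v set \<Rightarrow> ('a \<Rightarrow> 'v \<Rightarrow> real) \<Rightarrow> bool" where
  "strong_duality J V J_dual \<longleftrightarrow>
     (\<forall>\<theta>. (SUP v\<in>V. ereal (J_dual \<theta> v)) = ereal (J \<theta>))"

end

(* A gradient step on the upper bound costs J_up at most -|g|^2 / (2L), while the duality gap
   brings J_up back within rho |g|^2 / (2L) of J.  Hence J itself decreases by at least
   (1 - rho) |g|^2 / (2L) in each step, and being bounded below it forces g to vanish. *)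
theory Submission
  imports Defs
begin

text \<open>A nonincreasing sequence that is bounded below converges, so its consecutive differences
  tend to 0, and these differences dominate \<open>c * (norm (g n))\<^sup>2\<close>. The value of
  the limit is irrelevant.\<close>

lemma sufficient_decrease_tendsto_zero:
  fixes a :: "nat \<Rightarrow> real" and g :: "nat \<Rightarrow> 'a::real_normed_vector"
  assumes bounded_below: "\<And>n. b \<le> a n"
    and "0 < c"
    and decrease: "\<And>n. a (Suc n) + c * (norm (g n))\<^sup>2 \<le> a n"
  shows "g \<longlonglongrightarrow> 0"
proof -
  have "a (Suc n) \<le> a n" for n
    using decrease[of n] \<open>0 < c\<close> mult_nonneg_nonneg[of c "(norm (g n))\<^sup>2"]
    by (smt (verit) zero_le_power2)
  then have "decseq a"
    by (rule decseq_SucI)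
  then obtain l where l: "a \<longlonglongrightarrow> l"
    using decseq_convergent bounded_below by blast
  \<comment> \<open>The shifted sequence has the same limit \<open>l\<close>, which therefore
    cancels.\<close>
  then have "(\<lambda>n. (a n - a (Suc n)) / c) \<longlonglongrightarrow> (l - l) / c"
    using \<open>0 < c\<close> by (intro tendsto_intros LIMSEQ_Suc) auto
  then have *: "(\<lambda>n. (a n - a (Suc n)) / c) \<longlonglongrightarrow> 0"
    by simp
  have "(norm (g n))\<^sup>2 \<le> (a n - a (Suc n)) / c" for n
    using decrease[of n] \<open>0 < c\<close> by (simp add: pos_le_divide_eq mult.commute)
  then have "(\<lambda>n. (norm (g n))\<^sup>2) \<longlonglongrightarrow> 0"
    by (intro tendsto_sandwich[OF _ _ tendsto_const *]) auto
  then show ?thesis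
    by (simp add: tendsto_norm_zero_iff)
qed

theorem proposition2:
  fixes J :: "real ^ 'd \<Rightarrow> real"
    and U :: "(real ^ 'D) set"
    and J_up :: "real ^ 'd \<Rightarrow> real ^ 'D \<Rightarrow> real"
    and V :: "'v set"
    and J_low :: "real ^ 'd \<Rightarrow> 'v \<Rightarrow> real"
    and L \<rho> :: real
    and \<theta> :: "nat \<Rightarrow> real ^ 'd"
    and u :: "nat \<Rightarrow> real ^ 'D"
    and v :: "nat \<Rightarrow> 'v"
  assumes J_nonneg: "\<And>x. 0 \<le> J x"
    and J_diff: "J differentiable_on UNIV"
    and J_up_diff: "(\<lambda>(x, w). J_up x w) differentiable_on (UNIV \<times> U)"
    and J_up_ge: "\<And>x w. w \<in> U \<Longrightarrow> J_up x w \<ge> J x"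
    and J_up_convex: "\<And>x. convex_on U (J_up x)"
    and J_min: "\<And>x. \<exists>w. is_arg_min (J_up x) (\<lambda>w. w \<in> U) w \<and> J x = J_up x w"
    and J_low_le: "\<And>x z. z \<in> V \<Longrightarrow> J_low x z \<le> J x"
    and duality: "strong_duality J V J_low"
    and L_pos: "L > 0"
    and smooth: "\<And>x y w. w \<in> U \<Longrightarrow>
        J_up y w \<le> J_up x w + gradient (\<lambda>x'. J_up x' w) x \<bullet> (y - x) + L / 2 * (norm (y - x))\<^sup>2"
    and \<rho>: "\<rho> \<in> {0<..<1}"
    and u_in: "\<And>t. t \<ge> 1 \<Longrightarrow> u t \<in> U"
    and v_in: "\<And>t. t \<ge> 1 \<Longrightarrow> v t \<in> V"
    and gap: "\<And>t. t \<ge> 1 \<Longrightarrow>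
        J_up (\<theta> (t - 1)) (u t) - J_low (\<theta> (t - 1)) (v t)
          \<le> \<rho> / (2 * L) * (norm (gradient (\<lambda>x. J_up x (u t)) (\<theta> (t - 1))))\<^sup>2"
    and step: "\<And>t. t \<ge> 1 \<Longrightarrow>
        \<theta> t = \<theta> (t - 1) - (1 / L) *\<^sub>R gradient (\<lambda>x. J_up x (u t)) (\<theta> (t - 1))"
  shows "(\<lambda>t. gradient (\<lambda>x. J_up x (u t)) (\<theta> (t - 1))) \<longlonglongrightarrow> 0"
proof -
  \<comment> \<open>Shifting the index by one avoids the truncated subtraction \<open>t - 1\<close>
    and makes every hypothesis about \<open>t \<ge> 1\<close> available at
    \<open>Suc t\<close>.\<close>
  define g where "g t = gradient (\<lambda>x. J_up x (u (Suc t))) (\<theta> t)" for t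
  have "J (\<theta> (Suc t)) + (1 - \<rho>) / (2 * L) * (norm (g t))\<^sup>2 \<le> J (\<theta> t)" for t
  proof -
    let ?w = "u (Suc t)"
    have "?w \<in> U" and "v (Suc t) \<in> V"
      using u_in v_in by simp_all
    have diff: "\<theta> (Suc t) - \<theta> t = - (1 / L) *\<^sub>R g t"
      using step[of "Suc t"] by (simp add: g_def)
    \<comment> \<open>The upper bound at the new iterate keeps the parameter \<open>?w\<close> of
      the old one, so only the first argument of \<open>J_up\<close> changes and
      \<open>smooth\<close> applies.\<close>
    have "J (\<theta> (Suc t)) \<le> J_up (\<theta> (Suc t)) ?w"
      using J_up_ge \<open>?w \<in> U\<close> .
    also have "\<dots> \<le> J_up (\<theta> t) ?w + g t \<bullet> (\<theta> (Suc t) - \<theta> t)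
        + L / 2 * (norm (\<theta> (Suc t) - \<theta> t))\<^sup>2"
      using smooth[OF \<open>?w \<in> U\<close>] by (simp add: g_def)
    \<comment> \<open>With step size \<open>1 / L\<close> the linear term gives
      \<open>- (norm (g t))\<^sup>2 / L\<close>, and the quadratic term gives back half of
      that.\<close>
    also have "\<dots> = J_up (\<theta> t) ?w - 1 / (2 * L) * (norm (g t))\<^sup>2"
      unfolding diff using L_pos
      by (simp add: power_mult_distrib power_divide dot_square_norm field_simps power2_eq_square)
    also have "\<dots> \<le> J_low (\<theta> t) (v (Suc t)) + \<rho> / (2 * L) * (norm (g t))\<^sup>2
        - 1 / (2 * L) * (norm (g t))\<^sup>2"
      using gap[of "Suc t"] by (simp add: g_def)
    \<comment> \<open>Weak duality replaces \<open>J_low\<close> by \<open>J\<close> at the same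
      iterate; the constant is positive because \<rho> < 1.\<close>
    also have "\<dots> \<le> J (\<theta> t) - (1 - \<rho>) / (2 * L) * (norm (g t))\<^sup>2"
      using J_low_le[OF \<open>v (Suc t) \<in> V\<close>, of "\<theta> t"] by (simp add: diff_divide_distrib left_diff_distrib)
    finally show ?thesis
      by simp
  qed
  moreover have "0 < (1 - \<rho>) / (2 * L)"
    using \<rho> L_pos by simp
  ultimately have "g \<longlonglongrightarrow> 0"
    using sufficient_decrease_tendsto_zero[of 0 "\<lambda>t. J (\<theta> t)"] J_nonneg by blast
  then show ?thesis
    \<comment> \<open>Undoing the shift adds only the term at \<open>t = 0\<close>, where
      \<open>u 0\<close> is unconstrained and \<open>t - 1\<close> is \<open>0\<close>; a single
      term does not affect the limit.\<close>
    by (intro LIMSEQ_imp_Suc[where f = "\<lambda>t. gradient (\<lambda>x. J_up x (u t)) (\<theta> (t - 1))"])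
      (simp add: g_def[abs_def])
qed

end
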